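(* Let $k\geq 1$ be an integer and let $G$ be a finite, simple, undirected, connected graph. If $G$ is $k$-AT-free, then $pe(G)\leq k$.
   Context: For vertices $u,v$ of a graph $G$, $d(u,v)$ is the minimum length (number of edges) of a path between $u$ and $v$. For a subgraph $H$ of $G$ and a vertex $u$, $d(u,H)=\min_{v\in V(H)} d(u,v)$. A path $P$ in $G$ is a subgraph with distinct vertices $v_0,\dots,v_\ell$, $\ell\geq 0$, with $v_i$ adjacent to $v_{i+1}$ for $0\le i<\ell$ (it need not be induced). The eccentricity of a path $P$ of $G$ is $ecc(P)=\max\{d(u,P): u\in V(G)\}$, and the path eccentricity of $G$ is $pe(G)=\min\{ecc(P): P \text{ a path of } G\}$. For a vertex $v$ and an integer $k\geq 1$, $N^k[v]$ denotes the set of all vertices of $G$ at distance at most $k$ from $v$ (so $v\in N^k[v]$). A $k$-asteroidal triple ($k$-AT) of $G$ is a set of three vertices such that each pair of them is joined by a path of $G$ containing no vertex of $N^k[w]$, where $w$ is the third vertex of the set. A graph is $k$-AT-free if it contains no $k$-AT. *)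

theory Defs
  imports
    "Graph_Theory.Digraph_Component"
    "Graph_Theory.Vertex_Walk"
    "HOL-Library.Extended_Nat"
begin

text \<open>
  Finite simple undirected graphs are rendered by the locale predicate \<^term>\<open>graph\<close>
  (finite, symmetric, loop-free, without parallel arcs): an edge \<open>uv\<close> is the pair of arcs
  from \<open>u\<close> to \<open>v\<close> and from \<open>v\<close> to \<open>u\<close>.  A path is a nonempty list of distinct vertices,
  consecutive ones being adjacent (\<^term>\<open>vpath\<close>); a single vertex is a path of length 0.

  Distances and eccentricities are \<^typ>\<open>enat\<close>-valued, so that they are infinite (and not an
  arbitrary number) when no path exists.  On \<^typ>\<open>enat\<close> an infimum over a nonempty set is
  attained, and so is a supremum over a nonempty finite set, so these are the usual min and max.
\<close>

definition vdist :: "('a, 'b) pre_digraph \<Rightarrow> 'a \<Rightarrow> 'a \<Rightarrow> enat" where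
  "vdist G u v = (INF p \<in> {p. vpath p G \<and> hd p = u \<and> last p = v}. enat (vwalk_length p))"

text \<open>The distance from a vertex to a subgraph depends only on the subgraph's vertex set \<open>S\<close>.\<close>

definition vdist_set :: "('a, 'b) pre_digraph \<Rightarrow> 'a \<Rightarrow> 'a set \<Rightarrow> enat" where
  "vdist_set G u S = (INF v \<in> S. vdist G u v)"

definition path_ecc :: "('a, 'b) pre_digraph \<Rightarrow> 'a vwalk \<Rightarrow> enat" where
  "path_ecc G p = (SUP u \<in> verts G. vdist_set G u (set p))"

definition path_eccentricity :: "('a, 'b) pre_digraph \<Rightarrow> enat" where
  "path_eccentricity G = (INF p \<in> {p. vpath p G}. path_ecc G p)"

definition closed_nbhd :: "('a, 'b) pre_digraph \<Rightarrow> nat \<Rightarrow> 'a \<Rightarrow> 'a set" where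
  "closed_nbhd G k v = {u \<in> verts G. vdist G v u \<le> enat k}"

text \<open>
  As \<open>card A = 3\<close>, the equation \<open>A = {u, v, w}\<close> ranges over all the ways to split \<open>A\<close> into two
  distinct vertices \<open>u\<close>, \<open>v\<close> and the third vertex \<open>w\<close>.
\<close>

definition k_AT :: "nat \<Rightarrow> ('a, 'b) pre_digraph \<Rightarrow> 'a set \<Rightarrow> bool" where
  "k_AT k G A \<longleftrightarrow> A \<subseteq> verts G \<and> card A = 3 \<and>
     (\<forall>u v w. A = {u, v, w} \<longrightarrow>
        (\<exists>p. vpath p G \<and> hd p = u \<and> last p = v \<and> set p \<inter> closed_nbhd G k w = {}))"

definition k_AT_free :: "nat \<Rightarrow> ('a, 'b) pre_digraph \<Rightarrow> bool" where
  "k_AT_free k G \<longleftrightarrow> (\<nexists>A. k_AT k G A)"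

end

theory Submission
  imports Defs
begin

text \<open>
  Say that a path covers the vertices at distance at most \<open>k\<close> from it.  Among the paths that
  cover as many vertices as possible, let \<open>P\<close> be a shortest one, and suppose that it leaves
  a vertex \<open>z\<close> uncovered.  By the choice of \<open>P\<close>, no path contains \<open>P\<close> and \<open>z\<close>.  Let \<open>x\<close>
  and \<open>y\<close> be the ends of \<open>P\<close>, and join \<open>z\<close> to \<open>P\<close> by a path that meets \<open>P\<close> only in its
  end \<open>q\<close>.  Two kinds of connection outside \<open>P\<close> are impossible.

  \<^item> Neither \<open>x\<close> nor \<open>y\<close> is joined to \<open>z\<close> outside the rest of \<open>P\<close>: such a connection would
    prolong \<open>P\<close> to a path through \<open>z\<close> (\<open>extend_vpath\<close>).  In particular \<open>q\<close> is an inner vertex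
    of \<open>P\<close>.
  \<^item> The ends \<open>x\<close> and \<open>y\<close> are not joined to each other outside the interior of \<open>P\<close>: such a
    connection would close \<open>P\<close> to a cycle, and this cycle, cut open next to \<open>q\<close> and continued
    to \<open>z\<close>, is a path through \<open>P\<close> and \<open>z\<close> (\<open>cut_cycle\<close>).

  As \<open>P\<close> is shortest, removing \<open>x\<close> uncovers some vertex \<open>a\<close>, so that the ball of radius \<open>k\<close>
  around \<open>a\<close> meets \<open>P\<close> in \<open>x\<close> alone; in the same way \<open>y\<close> provides a vertex \<open>b\<close>
  (\<open>ex_private_hd\<close>).  Then \<open>a\<close>, \<open>b\<close>, \<open>z\<close> form a \<open>k\<close>-asteroidal triple.  The connections
  between them run along \<open>P\<close>, along the path from \<open>q\<close> to \<open>z\<close>, and along short paths from \<open>a\<close>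
  to \<open>x\<close> and from \<open>b\<close> to \<open>y\<close>.  If one of these entered the ball of the third vertex, then a
  detour through that ball, which touches \<open>P\<close> in at most one end, would be one of the two
  impossible connections.
\<close>

section \<open>Connections that avoid a set\<close>

lemma (in sym_digraph) vpath_rev:
  assumes "vpath p G"
  shows "vpath (rev p) G"
  using assms vwalk_rev_ex[OF sym_arcs] by (auto simp: vpath_def)

lemma vwalk_append_tl: "vwalk p G \<Longrightarrow> vwalk q G \<Longrightarrow> last p = hd q \<Longrightarrow> vwalk (p @ tl q) G"
  using vwalk_joinI_vwalk'[of p G q] by (simp add: vwalk_join_def)

lemma vpath_prefix: "vpath (p @ q) G \<Longrightarrow> p \<noteq> [] \<Longrightarrow> vpath p G"
  unfolding vpath_def by (auto intro: vwalkI_append_l)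

lemma vpath_suffix: "vpath (p @ q) G \<Longrightarrow> q \<noteq> [] \<Longrightarrow> vpath q G"
  unfolding vpath_def by (auto intro: vwalkI_append_r)

definition linked :: "('a, 'b) pre_digraph \<Rightarrow> 'a set \<Rightarrow> 'a \<Rightarrow> 'a \<Rightarrow> bool" where
  "linked G S u v \<longleftrightarrow> (\<exists>p. vpath p G \<and> hd p = u \<and> last p = v \<and> set p \<inter> S = {})"

lemma linkedI_vwalk:
  assumes "vwalk p G" "hd p = u" "last p = v" "set p \<inter> S = {}"
  shows "linked G S u v"
  unfolding linked_def
  using assms vwalk_to_vpath_vpath[OF assms(1)] vwalk_to_vpath_hd[of p] vwalk_to_vpath_last[of p]
    vwalk_to_vpath_subset[of _ p]
  by (intro exI[of _ "vwalk_to_vpath p"]) auto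

lemma linked_antimono: "linked G T u v \<Longrightarrow> S \<subseteq> T \<Longrightarrow> linked G S u v"
  unfolding linked_def by blast

lemma linked_trans:
  assumes "linked G S u v" "linked G S v w"
  shows "linked G S u w"
proof -
  from assms obtain p q where p: "vpath p G" "hd p = u" "last p = v" "set p \<inter> S = {}"
    and q: "vpath q G" "hd q = v" "last q = w" "set q \<inter> S = {}"
    unfolding linked_def by blast
  then have ne: "p \<noteq> []" "q \<noteq> []" by (auto simp: vpath_def vwalk_def)
  have "vwalk (p @ tl q) G" using p q by (intro vwalk_append_tl) (auto simp: vpath_def)
  moreover have "last (p @ tl q) = w" using p q ne by (cases q) (auto simp: last_append)
  moreover have "set (p @ tl q) \<inter> S = {}" using p q ne by (cases q) auto
  ultimately show ?thesis using p ne by (intro linkedI_vwalk[of "p @ tl q"]) auto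
qed

lemma (in sym_digraph) linked_sym: "linked G S u v \<Longrightarrow> linked G S v u"
  unfolding linked_def
  by (metis vpath_rev hd_rev last_rev set_rev)

text \<open>
  The last conjunct holds because a path does not return to its first vertex: if \<open>u\<close> is the only
  vertex of a path \<open>P\<close> outside \<open>S\<close>, it says that the remaining connection avoids all of \<open>P\<close>.
\<close>

lemma linked_or_meets:
  assumes "linked G S u v" "\<not> linked G T u v"
  shows "\<exists>m\<in>T. linked G S u m \<and> linked G S m v \<and> (m \<noteq> u \<longrightarrow> linked G (insert u S) m v)"
proof -
  from assms obtain p where p: "vpath p G" "hd p = u" "last p = v" "set p \<inter> S = {}"
    unfolding linked_def by blast
  with assms(2) obtain m where m: "m \<in> T" "m \<in> set p" unfolding linked_def by blast
  then obtain p1 p2 where d: "p = p1 @ m # p2" by (meson split_list)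
  have 1: "vpath (p1 @ [m]) G" "vpath (m # p2) G"
    using p(1) vpath_prefix[of "p1 @ [m]" p2] vpath_suffix[of p1 "m # p2"] unfolding d by auto
  have hd: "hd (p1 @ [m]) = u" using p(2) d by (cases p1) auto
  have dist: "distinct p" using p(1) by (auto simp: vpath_def)
  have "u \<notin> set (m # p2)" if "m \<noteq> u"
    using dist p(2) that unfolding d by (cases p1) auto
  then have "m \<noteq> u \<longrightarrow> linked G (insert u S) m v"
    unfolding linked_def using 1(2) p(3,4) d by (intro impI exI[of _ "m # p2"]) auto
  moreover have "linked G S u m"
    unfolding linked_def using 1 p hd d by (intro exI[of _ "p1 @ [m]"]) auto
  moreover have "linked G S m v"
    unfolding linked_def using 1 p hd d by (intro exI[of _ "m # p2"]) auto
  ultimately show ?thesis using m by blast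
qed

section \<open>Balls of radius k\<close>

lemma vdist_le_iff:
  "vdist G u v \<le> enat k \<longleftrightarrow> (\<exists>p. vpath p G \<and> hd p = u \<and> last p = v \<and> vwalk_length p \<le> k)"
proof
  let ?A = "(\<lambda>p. enat (vwalk_length p)) ` {p. vpath p G \<and> hd p = u \<and> last p = v}"
  assume le: "vdist G u v \<le> enat k"
  have "?A \<noteq> {}"
  proof
    assume "?A = {}"
    then have "vdist G u v = \<infinity>" unfolding vdist_def by (simp only: Inf_enat_def simp_thms if_True)
    with le show False by simp
  qed
  then have "Inf ?A \<in> ?A" by (auto simp: Inf_enat_def intro: LeastI)
  with le show "\<exists>p. vpath p G \<and> hd p = u \<and> last p = v \<and> vwalk_length p \<le> k"
    unfolding vdist_def by auto
next
  assume "\<exists>p. vpath p G \<and> hd p = u \<and> last p = v \<and> vwalk_length p \<le> k"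
  then show "vdist G u v \<le> enat k" unfolding vdist_def by (auto intro: INF_lower2)
qed

lemma (in sym_digraph) vdist_sym_le: "vdist G u v \<le> enat k \<Longrightarrow> vdist G v u \<le> enat k"
  unfolding vdist_le_iff
  by (metis vpath_rev hd_rev last_rev length_rev vwalk_length_simp)

lemma (in sym_digraph) closed_nbhd_sym:
  "v \<in> closed_nbhd G k u \<Longrightarrow> u \<in> verts G \<Longrightarrow> u \<in> closed_nbhd G k v"
  using vdist_sym_le by (auto simp: closed_nbhd_def)

lemma self_in_closed_nbhd: "v \<in> verts G \<Longrightarrow> v \<in> closed_nbhd G k v"
  by (auto simp: closed_nbhd_def vdist_le_iff intro!: exI[of _ "[v]"] vpath_self)

text \<open>
  A shortest path from the centre of a ball to a vertex of the ball stays inside the ball.  This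
  is the only way in which distances enter the argument.
\<close>

lemma linked_centre_closed_nbhd:
  assumes "m \<in> closed_nbhd G k w" "closed_nbhd G k w \<inter> S = {}"
  shows "linked G S w m"
proof -
  from assms obtain p where p: "vpath p G" "hd p = w" "last p = m" "vwalk_length p \<le> k"
    by (auto simp: closed_nbhd_def vdist_le_iff)
  have "v \<in> closed_nbhd G k w" if "v \<in> set p" for v
  proof -
    from that obtain p1 p2 where d: "p = p1 @ v # p2" by (meson split_list)
    have "vpath (p1 @ [v]) G" using p(1) vpath_prefix[of "p1 @ [v]" p2] unfolding d by auto
    moreover have "hd (p1 @ [v]) = w" using p(2) d by (cases p1) auto
    moreover have "vwalk_length (p1 @ [v]) \<le> k" using p(4) d by auto
    moreover have "v \<in> verts G" using p(1) that by (auto simp: vpath_def)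
    ultimately show ?thesis unfolding closed_nbhd_def vdist_le_iff
      by (intro CollectI conjI exI[of _ "p1 @ [v]"]) auto
  qed
  with p assms(2) show ?thesis unfolding linked_def by (intro exI[of _ p]) auto
qed

section \<open>Enlarging the vertex set of a path\<close>

lemma extend_vpath:
  assumes p: "vpath p G" and l: "linked G (set p - {last p}) (last p) z"
  shows "\<exists>q. vpath q G \<and> set p \<union> {z} \<subseteq> set q"
proof -
  from l obtain c where c: "vpath c G" "hd c = last p" "last c = z"
    "set c \<inter> (set p - {last p}) = {}" unfolding linked_def by blast
  then have ne: "c \<noteq> []" "p \<noteq> []" using p by (auto simp: vpath_def vwalk_def)
  have "vwalk (p @ tl c) G" using p c by (intro vwalk_append_tl) (auto simp: vpath_def)
  moreover have "distinct (p @ tl c)" using p c ne by (cases c) (auto simp: vpath_def)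
  moreover have "z \<in> set (p @ tl c)" using c ne by (cases c) (auto split: if_splits)
  ultimately show ?thesis by (intro exI[of _ "p @ tl c"]) (auto simp: vpath_def)
qed

lemma (in sym_digraph) extend_vpath_hd:
  assumes p: "vpath p G" and l: "linked G (set p - {hd p}) (hd p) z"
  shows "\<exists>q. vpath q G \<and> set p \<union> {z} \<subseteq> set q"
  using extend_vpath[of "rev p" G z] vpath_rev[OF p] l p
  by (auto simp: last_rev vpath_def vwalk_def)

text \<open>
  The path \<open>p\<close> and the connection between its ends form a cycle.  Starting at the successor
  of \<open>q\<close> on \<open>p\<close>, one runs once round this cycle back to \<open>q\<close> and leaves it towards \<open>z\<close>.  If
  this is not a path because the way to \<open>z\<close> meets the connection between the ends, or because
  \<open>q\<close> is itself an end, then an end of \<open>p\<close> reaches \<open>z\<close> outside \<open>p\<close> and \<open>p\<close> can be prolonged.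
\<close>

lemma (in sym_digraph) cut_cycle:
  assumes p: "vpath p G"
    and ret: "linked G (set p - {hd p, last p}) (last p) (hd p)"
    and c: "q \<in> set p" "linked G (set p - {q}) q z"
  shows "\<exists>r. vpath r G \<and> set p \<union> {z} \<subseteq> set r"
proof (rule ccontr)
  assume nr: "\<not> ?thesis"
  have x: "\<not> linked G (set p - {hd p}) (hd p) z" using extend_vpath_hd[OF p] nr by blast
  have y: "\<not> linked G (set p - {last p}) (last p) z" using extend_vpath[OF p] nr by blast
  have dp: "distinct p" and pne: "p \<noteq> []" using p by (auto simp: vpath_def vwalk_def)
  have q: "q \<noteq> hd p" "q \<noteq> last p" using x y c by auto
  obtain p1 p2 where d: "p = p1 @ q # p2" using c(1) by (meson split_list)
  have ne: "p1 \<noteq> []" "p2 \<noteq> []" using q unfolding d by auto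
  obtain e where e: "vpath e G" "hd e = q" "last e = z" "set e \<inter> (set p - {q}) = {}"
    using c(2) unfolding linked_def by blast
  obtain b where b: "vpath b G" "hd b = last p" "last b = hd p"
    "set b \<inter> (set p - {hd p, last p}) = {}" using ret unfolding linked_def by blast
  have ene: "e \<noteq> []" "b \<noteq> []" using e b by (auto simp: vpath_def vwalk_def)
  have hl: "hd p \<noteq> last p" using dp ne unfolding d by (cases p1; cases p2) auto
  \<comment> \<open>Through a common vertex \<open>v\<close> one could go from \<open>last p\<close> along \<open>b\<close> and on to \<open>z\<close> along \<open>e\<close>.\<close>
  have disj: "set b \<inter> set e = {}"
  proof (rule ccontr)
    assume "\<not> ?thesis"
    then obtain v where v: "v \<in> set b" "v \<in> set e" by blast
    have vp: "v \<notin> set p"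
      using v b(4) e(4) q by auto
    obtain b1 b2 where b12: "b = b1 @ v # b2" using v(1) by (meson split_list)
    obtain e1 e2 where e12: "e = e1 @ v # e2" using v(2) by (meson split_list)
    have "b2 \<noteq> []" using b(3) vp pne unfolding b12 by auto
    then have "hd p \<in> set b2" using b(3) last_in_set[of b2] unfolding b12 by simp
    then have "hd p \<notin> set (b1 @ [v])" using b(1) unfolding b12 by (auto simp: vpath_def)
    then have lv: "linked G (set p - {last p}) (last p) v"
      unfolding linked_def using b vpath_prefix[of "b1 @ [v]" b2 G] unfolding b12
      by (intro exI[of _ "b1 @ [v]"]) (cases b1; auto)
    have "e1 \<noteq> []" using e(2) vp c(1) unfolding e12 by auto
    then have "q \<notin> set (v # e2)" using e(1,2) unfolding e12 by (cases e1) (auto simp: vpath_def)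
    then have "linked G (set p - {last p}) v z"
      unfolding linked_def using e vpath_suffix[of e1 "v # e2" G] unfolding e12
      by (intro exI[of _ "v # e2"]) auto
    with lv y show False using linked_trans[OF lv] by blast
  qed
  \<comment> \<open>Here \<open>tl\<close> removes the vertex shared with the preceding piece; \<open>hd p\<close> is visited as the
    last vertex of \<open>b\<close>.\<close>
  let ?r = "((p2 @ tl b) @ tl (p1 @ [q])) @ tl e"
  have w: "vwalk p2 G" "vwalk (p1 @ [q]) G" "vwalk e G" "vwalk b G"
    using p e b ne vpath_suffix[of "p1 @ [q]" p2 G] vpath_prefix[of "p1 @ [q]" p2 G]
    unfolding d by (auto simp: vpath_def)
  have l1: "last (p2 @ tl b) = hd (p1 @ [q])"
    using b(2,3) ene hl ne unfolding d by (cases b) (auto simp: last_append)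
  have l2: "last ((p2 @ tl b) @ tl (p1 @ [q])) = hd e" using e(2) ne by (cases p1) auto
  have "vwalk ?r G"
    using w l1 l2 b(2) ne unfolding d by (intro vwalk_append_tl) auto
  moreover have "distinct ?r"
  proof -
    obtain b' where b': "b = last p2 # b'" using b(2) ene ne unfolding d by (cases b) auto
    obtain x p1' where p1: "p1 = x # p1'" using ne by (cases p1) auto
    obtain e' where e': "e = q # e'" using e(2) ene by (cases e) auto
    have ends: "hd p = x" "last p = last p2" "last p2 \<in> set p2"
      and sp: "set p = {x, q} \<union> set p1' \<union> set p2"
      using ne unfolding d p1 by auto
    have dd: "x \<notin> set p1'" "x \<noteq> q" "x \<notin> set p2" "q \<notin> set p1'" "q \<notin> set p2"
      "set p1' \<inter> set p2 = {}" "distinct p1'" "distinct p2"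
      using dp unfolding d p1 by auto
    have db: "last p2 \<notin> set b'" "distinct b'" using b(1) unfolding b' by (auto simp: vpath_def)
    have de: "q \<notin> set e'" "distinct e'" using e(1) unfolding e' by (auto simp: vpath_def)
    have "set b' \<inter> (set p - {x, last p2}) = {}" using b(4) ends b' by auto
    then have "set b' \<inter> ({q} \<union> set p1' \<union> set p2) = {}"
      using db(1) dd(1-6) ends(3) unfolding sp by blast
    moreover have "set e' \<inter> set p = {}" using e(4) de unfolding e' by auto
    then have "set e' \<inter> ({q} \<union> set p1' \<union> set p2) = {}" unfolding sp by blast
    moreover have "set b' \<inter> set e' = {}" using disj unfolding b' e' by auto
    ultimately show ?thesis using dd(4-8) db(2) de unfolding b' p1 e'
      by (simp add: Int_Un_distrib Int_commute)
  qed
  moreover have "set p \<union> {z} \<subseteq> set ?r"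
  proof -
    have "tl b \<noteq> []" "last (tl b) = hd p"
      using b(2,3) hl ene by (cases b; auto split: if_splits)+
    then have "hd p \<in> set (tl b)" using last_in_set by metis
    moreover have "z \<in> insert q (set (tl e))"
      using e(2,3) last_in_set[OF ene(1)] by (cases e) auto
    ultimately show ?thesis using ne unfolding d by (cases p1) auto
  qed
  ultimately show False using nr unfolding vpath_def by blast
qed

section \<open>Linking a private vertex of an end to an uncovered vertex\<close>

text \<open>
  The vertices \<open>a\<close> and \<open>b\<close> are private to the two ends of \<open>p\<close>: among the vertices of \<open>p\<close>, only
  the respective end is within distance \<open>k\<close>.  The connection goes from \<open>a\<close> to \<open>hd p\<close>, along \<open>p\<close>
  to \<open>q\<close>, and on to \<open>z\<close>.  The ball around \<open>b\<close> cannot meet it, since every vertex of that ball is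
  joined to \<open>last p\<close> outside the rest of \<open>p\<close>: meeting the first part would join the two ends of
  \<open>p\<close>, meeting the last part would join \<open>last p\<close> to \<open>z\<close>, and the middle part does not contain
  \<open>last p\<close>.
\<close>

lemma (in sym_digraph) private_end_linked:
  assumes p: "vpath p G"
    and z: "\<And>r. vpath r G \<Longrightarrow> \<not> set p \<union> {z} \<subseteq> set r"
    and q: "q \<in> set p" "linked G (set p - {q}) q z"
    and a: "hd p \<in> closed_nbhd G k a" "closed_nbhd G k a \<inter> (set p - {hd p}) = {}"
    and b: "last p \<in> closed_nbhd G k b" "closed_nbhd G k b \<inter> (set p - {last p}) = {}"
  shows "linked G (closed_nbhd G k b) a z"
proof -
  let ?B = "closed_nbhd G k b" and ?P = "set p"
  have y: "\<not> linked G (?P - {last p}) (last p) z" using extend_vpath[OF p] z by blast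
  have xy: "\<not> linked G (?P - {hd p, last p}) (last p) (hd p)"
    using cut_cycle[OF p _ q] z by blast
  have qy: "q \<noteq> last p" using y q by auto
  have near_b: "linked G (?P - {last p}) (last p) m" if "m \<in> ?B" for m
    using linked_trans[OF linked_sym[OF linked_centre_closed_nbhd[OF b]]
      linked_centre_closed_nbhd[OF that b(2)]] .
  have ax: "linked G ?B a (hd p)"
  proof (rule ccontr)
    assume "\<not> ?thesis"
    then obtain m where m: "m \<in> ?B" "linked G (?P - {hd p}) m (hd p)"
      using linked_or_meets[OF linked_centre_closed_nbhd[OF a]] by blast
    have "linked G (?P - {hd p, last p}) (last p) m"
      using near_b[OF m(1)] by (rule linked_antimono) auto
    moreover have "linked G (?P - {hd p, last p}) m (hd p)"
      using m(2) by (rule linked_antimono) auto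
    ultimately show False using xy linked_trans[of G _ "last p" m] by blast
  qed
  have xq: "linked G ?B (hd p) q"
  proof -
    obtain p1 p2 where d: "p = p1 @ q # p2" using q(1) by (meson split_list)
    with qy have "p2 \<noteq> []" by auto
    then have "last p \<in> set p2" using d by auto
    then have "last p \<notin> set (p1 @ [q])" using p unfolding d by (auto simp: vpath_def)
    then show ?thesis unfolding linked_def
      using vpath_prefix[of "p1 @ [q]" p2 G] p b(2) unfolding d
      by (intro exI[of _ "p1 @ [q]"]) (cases p1; auto)
  qed
  have qz: "linked G ?B q z"
  proof (rule ccontr)
    assume "\<not> ?thesis"
    then obtain m where m: "m \<in> ?B" "m \<noteq> q \<longrightarrow> linked G (insert q (?P - {q})) m z"
      using linked_or_meets[OF q(2)] by blast
    have "m \<noteq> q" using m(1) b(2) q(1) qy by blast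
    then have "linked G (?P - {last p}) m z" using m(2) by (auto elim!: linked_antimono)
    from linked_trans[OF near_b[OF m(1)] this] show False using y by blast
  qed
  show ?thesis using linked_trans[OF linked_trans[OF ax xq] qz] .
qed

section \<open>Paths of maximal coverage\<close>

definition covered :: "('a, 'b) pre_digraph \<Rightarrow> nat \<Rightarrow> 'a vwalk \<Rightarrow> 'a set" where
  "covered G k p = (\<Union>v\<in>set p. closed_nbhd G k v)"

lemma (in sym_digraph) in_covered_iff:
  assumes "vwalk p G"
  shows "u \<in> covered G k p \<longleftrightarrow> u \<in> verts G \<and> closed_nbhd G k u \<inter> set p \<noteq> {}"
proof -
  have "v \<in> verts G" if "v \<in> set p" for v using that assms by auto
  moreover have "u \<in> verts G" if "u \<in> closed_nbhd G k v" for v using that by (auto simp: closed_nbhd_def)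
  ultimately show ?thesis unfolding covered_def using closed_nbhd_sym by blast
qed

lemma (in sym_digraph) path_eccentricity_le_if_covered:
  assumes p: "vpath p G" and cov: "verts G \<subseteq> covered G k p"
  shows "path_eccentricity G \<le> enat k"
proof -
  have "vdist_set G u (set p) \<le> enat k" if u: "u \<in> verts G" for u
  proof -
    from u cov obtain v where "v \<in> set p" "u \<in> closed_nbhd G k v" by (auto simp: covered_def)
    then show ?thesis unfolding vdist_set_def
      using vdist_sym_le by (auto simp: closed_nbhd_def intro!: INF_lower2[of v])
  qed
  then have "path_ecc G p \<le> enat k" unfolding path_ecc_def by (auto intro: SUP_least)
  then show ?thesis unfolding path_eccentricity_def using p by (auto intro: INF_lower2)
qed

lemma (in fin_digraph) ex_max_covered_min_length:
  assumes ne: "verts G \<noteq> {}"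
  obtains p where "vpath p G"
    "\<And>q. vpath q G \<Longrightarrow> card (covered G k q) \<le> card (covered G k p)"
    "\<And>q. vpath q G \<Longrightarrow> length q < length p \<Longrightarrow> card (covered G k q) < card (covered G k p)"
proof -
  have sub: "covered G k q \<subseteq> verts G" for q by (auto simp: covered_def closed_nbhd_def)
  then have bound: "card (covered G k q) \<le> card (verts G)" for q by (rule card_mono[OF finite_verts])
  from ne obtain v where "v \<in> verts G" by blast
  then have "vpath [v] G" by (rule vpath_self)
  then obtain p0 where p0: "vpath p0 G"
    "\<And>q. vpath q G \<Longrightarrow> card (covered G k q) \<le> card (covered G k p0)"
    using ex_has_greatest_nat[of "\<lambda>q. vpath q G" "[v]" "\<lambda>q. card (covered G k q)" "Suc (card (verts G))"]
      bound by (metis le_imp_less_Suc)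
  let ?M = "\<lambda>q. vpath q G \<and> card (covered G k q) = card (covered G k p0)"
  obtain p where p: "?M p" "\<And>q. ?M q \<Longrightarrow> length p \<le> length q"
    using ex_has_least_nat[of ?M p0 length] p0(1) by blast
  show thesis
  proof (rule that)
    fix q assume "vpath q G" "length q < length p"
    then show "card (covered G k q) < card (covered G k p)"
      using p p0(2)[of q] by (metis leD order_le_imp_less_or_eq)
  qed (use p p0 in auto)
qed

text \<open>
  A path of least length among those of maximal coverage covers less without its first vertex;
  what is lost are the vertices \<open>a\<close> for which that vertex is indispensable.
\<close>

lemma (in sym_digraph) ex_private_hd:
  assumes p: "vpath p G" and fin: "finite (verts G)"
    and less: "card (covered G k (tl p)) < card (covered G k p)" and ne: "tl p \<noteq> []"
  obtains a where "a \<in> verts G" "hd p \<in> closed_nbhd G k a"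
    "closed_nbhd G k a \<inter> (set p - {hd p}) = {}"
proof -
  obtain x p' where d: "p = x # p'" using ne by (cases p) auto
  have w: "vwalk p G" "vwalk p' G" using p ne vpath_suffix[of "[x]" p' G]
    unfolding d by (auto simp: vpath_def)
  have "\<not> covered G k p \<subseteq> covered G k p'"
  proof
    assume "covered G k p \<subseteq> covered G k p'"
    moreover have "finite (covered G k p')"
      by (rule finite_subset[OF _ fin]) (auto simp: covered_def closed_nbhd_def)
    ultimately show False using less d by (auto dest: card_mono)
  qed
  then obtain a where "a \<in> covered G k p" "a \<notin> covered G k p'" by blast
  then show thesis using that w p unfolding d by (auto simp: in_covered_iff vpath_def)
qed

text \<open>
  The definition of a \<open>k\<close>-asteroidal triple asks for a connection for each of the six ways to
  order the triple; by symmetry three of them are enough.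
\<close>

lemma (in sym_digraph) k_ATI:
  assumes "{a, b, c} \<subseteq> verts G" "a \<noteq> b" "b \<noteq> c" "a \<noteq> c"
    and "linked G (closed_nbhd G k c) a b" "linked G (closed_nbhd G k b) a c"
    "linked G (closed_nbhd G k a) b c"
  shows "k_AT k G {a, b, c}"
proof -
  have "linked G (closed_nbhd G k w) u v" if "{a, b, c} = {u, v, w}" for u v w
  proof -
    have "a \<in> {u, v, w}" "b \<in> {u, v, w}" "c \<in> {u, v, w}" using that by blast+
    then show ?thesis
      using assms(2-7) assms(5-7)[THEN linked_sym] by (elim insertE emptyE) simp_all
  qed
  then have "\<forall>u v w. {a, b, c} = {u, v, w} \<longrightarrow> linked G (closed_nbhd G k w) u v" by blast
  moreover have "card {a, b, c} = 3" using assms(2-4) by simp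
  ultimately show ?thesis using assms(1) unfolding k_AT_def linked_def by blast
qed

theorem theorem3:
  fixes G :: "('a, 'b) pre_digraph" and k :: nat
  assumes "k \<ge> 1"
    and "graph G"
    and "Digraph_Component.connected G"
    and "k_AT_free k G"
  shows "path_eccentricity G \<le> enat k"
proof (rule ccontr)
  assume large: "\<not> path_eccentricity G \<le> enat k"
  interpret graph G by fact
  have conn: "strongly_connected G"
    using symmetric_connected_imp_strongly_connected assms(3) by blast
  then have "verts G \<noteq> {}" by (auto simp: strongly_connected_def)
  then obtain p where p: "vpath p G"
    and max: "\<And>q. vpath q G \<Longrightarrow> card (covered G k q) \<le> card (covered G k p)"
    and min: "\<And>q. vpath q G \<Longrightarrow> length q < length p \<Longrightarrow>
      card (covered G k q) < card (covered G k p)"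
    by (rule ex_max_covered_min_length[where k = k]) blast
  have pw: "vwalk p G" "distinct p" "p \<noteq> []" using p by (auto simp: vpath_def vwalk_def)
  obtain z where z: "z \<in> verts G" "z \<notin> covered G k p"
    using large path_eccentricity_le_if_covered[OF p] by blast
  then have zp: "closed_nbhd G k z \<inter> set p = {}" using in_covered_iff pw by blast
  \<comment> \<open>Such a path would cover \<open>z\<close> and all that \<open>p\<close> covers.\<close>
  have no_ext: "\<not> set p \<union> {z} \<subseteq> set r" if r: "vpath r G" for r
  proof
    assume s: "set p \<union> {z} \<subseteq> set r"
    have "z \<in> covered G k r" using s self_in_closed_nbhd[OF z(1)] unfolding covered_def by blast
    then have "covered G k p \<subset> covered G k r" using s z unfolding covered_def by blast
    moreover have "finite (covered G k r)"
      by (rule finite_subset[OF _ finite_verts]) (auto simp: covered_def closed_nbhd_def)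
    ultimately show False using max[OF r] psubset_card_mono by (metis leD)
  qed
  \<comment> \<open>\<open>q\<close> is the last vertex of \<open>p\<close> on some path from \<open>hd p\<close> to \<open>z\<close>.\<close>
  obtain q where q: "q \<in> set p" "linked G (set p - {q}) q z"
  proof -
    have "hd p \<in> verts G" using pw hd_in_set[of p] by blast
    then have "hd p \<rightarrow>\<^sup>*\<^bsub>G\<^esub> z" using conn z by (auto simp: strongly_connected_def)
    then obtain c where c: "vpath c G" "hd c = hd p" "last c = z" by (auto simp: reachable_vpath_conv)
    then have "hd p \<in> set c" by (metis hd_in_set vpath_def vwalk_def)
    then have "\<exists>v\<in>set c. v \<in> set p" using pw hd_in_set[of p] by blast
    then obtain c1 v c2 where d: "c = c1 @ v # c2" "v \<in> set p" "\<forall>u\<in>set c2. u \<notin> set p"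
      using split_list_last_prop[of c "\<lambda>v. v \<in> set p"] by blast
    then have "linked G (set p - {v}) v z" unfolding linked_def
      using c vpath_suffix[of c1 "v # c2" G] by (intro exI[of _ "v # c2"]) auto
    with d that show thesis by blast
  qed
  have x: "\<not> linked G (set p - {hd p}) (hd p) z" using extend_vpath_hd[OF p] no_ext by blast
  have y: "\<not> linked G (set p - {last p}) (last p) z" using extend_vpath[OF p] no_ext by blast
  \<comment> \<open>If \<open>p\<close> were a single vertex, then \<open>q\<close> would be its end, against \<open>x\<close>.\<close>
  have tl: "tl p \<noteq> []"
  proof
    assume "tl p = []"
    then have "q = hd p" using q(1) pw by (cases p) auto
    then show False using x q by blast
  qed
  then have xy: "hd p \<noteq> last p" using pw by (cases p) auto
  have vtl: "vpath (tl p) G" using p tl vpath_suffix[of "[hd p]" "tl p" G] pw by (cases p) auto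
  obtain a where a: "a \<in> verts G" "hd p \<in> closed_nbhd G k a"
    "closed_nbhd G k a \<inter> (set p - {hd p}) = {}"
    using ex_private_hd[OF p finite_verts min[OF vtl] tl] pw by auto
  obtain b where b: "b \<in> verts G" "last p \<in> closed_nbhd G k b"
    "closed_nbhd G k b \<inter> (set p - {last p}) = {}"
  proof -
    have tl': "tl (rev p) \<noteq> []" using tl by (cases p) (auto simp: tl_append split: list.split)
    have "vpath (tl (rev p)) G"
      using vpath_rev[OF p] tl' vpath_suffix[of "[hd (rev p)]" "tl (rev p)" G] pw by auto
    moreover have "covered G k (rev p) = covered G k p" by (simp add: covered_def)
    ultimately have "card (covered G k (tl (rev p))) < card (covered G k (rev p))"
      using min[of "tl (rev p)"] pw by auto
    from ex_private_hd[OF vpath_rev[OF p] finite_verts this tl'] that show thesis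
      using pw by (auto simp: hd_rev)
  qed
  have bz: "linked G (closed_nbhd G k b) a z"
    using private_end_linked[OF p no_ext q a(2,3) b(2,3)] .
  have az: "linked G (closed_nbhd G k a) b z"
    using private_end_linked[of "rev p" z q k b a] vpath_rev[OF p] no_ext q a b pw
    by (auto simp: hd_rev last_rev)
  \<comment> \<open>If the ball around \<open>z\<close> met the short path from \<open>a\<close> to \<open>hd p\<close>, then \<open>hd p\<close> would be
    joined to \<open>z\<close> outside the rest of \<open>p\<close>; likewise at the other end.\<close>
  have za: "linked G (closed_nbhd G k z) a (hd p)"
  proof (rule ccontr)
    assume "\<not> ?thesis"
    then obtain m where m: "m \<in> closed_nbhd G k z" "linked G (set p - {hd p}) m (hd p)"
      using linked_or_meets[OF linked_centre_closed_nbhd[OF a(2,3)]] by blast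
    have "linked G (set p - {hd p}) z m"
      using m(1) zp by (intro linked_centre_closed_nbhd) auto
    from linked_sym[OF linked_trans[OF this m(2)]] show False using x by blast
  qed
  have zb: "linked G (closed_nbhd G k z) b (last p)"
  proof (rule ccontr)
    assume "\<not> ?thesis"
    then obtain m where m: "m \<in> closed_nbhd G k z" "linked G (set p - {last p}) m (last p)"
      using linked_or_meets[OF linked_centre_closed_nbhd[OF b(2,3)]] by blast
    have "linked G (set p - {last p}) z m"
      using m(1) zp by (intro linked_centre_closed_nbhd) auto
    from linked_sym[OF linked_trans[OF this m(2)]] show False using y by blast
  qed
  have "linked G (closed_nbhd G k z) (hd p) (last p)"
    unfolding linked_def using p zp by blast
  then have ab: "linked G (closed_nbhd G k z) a b"
    using linked_trans[OF linked_trans[OF za] linked_sym[OF zb]] by blast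
  have "last p \<in> set p" "hd p \<in> set p" using pw by auto
  then have "a \<noteq> b" "b \<noteq> z" "a \<noteq> z" using a b zp xy by auto
  then have "k_AT k G {a, b, z}"
    using a b z ab bz az by (intro k_ATI) auto
  then show False using assms(4) unfolding k_AT_free_def by blast
qed

end
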